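(* Let $V$ be a finite-dimensional real inner product space, $\Omega\subseteq V$ a full-dimensional lattice, and $\mathcal{W}\subseteq\mathrm{GL}(V)$ a finite group with $s(\Omega)=\Omega$ for all $s\in\mathcal{W}$. Let $f=\sum_{\mu\in\Omega}f_\mu\,\mathfrak{e}^\mu$ be a trigonometric polynomial with $f_\mu=\overline{f_{-\mu}}$, let $d\in\mathbb{N}$ be the minimal integer such that $\mu\in\Omega_d+\Omega_d$ whenever $f_\mu\neq0$, and assume $s(\Omega_d)=\Omega_d$ for all $s\in\mathcal{W}$. Then $\mathbf{mat}(f)\in\mathrm{Toep}_d^{\mathcal{W}}$ if and only if $f$ is $\mathcal{W}$-invariant.
   Context: Let $\langle\cdot,\cdot\rangle$ be the inner product on $V$ with norm $\|u\|=\sqrt{\langle u,u\rangle}$. The dual lattice of $\Omega$ is $\Lambda=\{\lambda\in V \mid \langle\mu,\lambda\rangle\in\mathbb{Z}\ \text{for all}\ \mu\in\Omega\}$. The Voronoi cell of $\Lambda$ is $\mathrm{Vor}(\Lambda)=\{u\in V\mid \|u\|\le\|u-\lambda\|\ \text{for all}\ \lambda\in\Lambda\}$. For $d\in\mathbb{N}=\{0,1,2,\ldots\}$, $\Omega_d:=\Omega\cap d\,\mathrm{Vor}(\Lambda)$, which is a finite set. For $\mu\in\Omega$ and $u\in V$, $\mathfrak{e}^\mu(u):=\exp(-2\pi \mathrm{i}\langle\mu,u\rangle)$. A trigonometric polynomial is a function $f:V\to\mathbb{R}$, $f=\sum_{\mu\in\Omega}f_\mu\,\mathfrak{e}^\mu$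 with $f_\mu=\overline{f_{-\mu}}\in\mathbb{C}$, all but finitely many $f_\mu$ being zero. A group element $s\in\mathcal{W}$ acts by $s\cdot f=\sum_{\mu}f_\mu\,\mathfrak{e}^{s(\mu)}$; $f$ is $\mathcal{W}$-invariant if $s\cdot f=f$ for all $s\in\mathcal{W}$. $\mathrm{Toep}_d$ denotes the real vector space of Hermitian matrices $\mathbf{X}$ with complex entries $\mathbf{X}_{\mu\nu}$, rows and columns indexed by $\Omega_d$, that are Toeplitz, meaning that $\mathbf{X}_{\mu\nu}$ depends only on $\mu-\nu$. Let $\mathbf{E}_d(u)$ be the column vector with entries $\mathfrak{e}^\mu(u)/\sqrt{|\Omega_d|}$, $\mu\in\Omega_d$. Then $\mathbf{mat}(f)$ denotes the unique matrix in $\mathrm{Toep}_d$ with $f(u)=\mathbf{E}_d(u)^\dagger\,\mathbf{mat}(f)\,\mathbf{E}_d(u)$ for all $u\in V$, where $\dagger$ is the conjugate transpose. $\mathcal{W}$ acts on $\mathrm{Toep}_d$ by $(s\star\mathbf{X})_{\mu\nu}:=\mathbf{X}_{s^{-1}(\mu)\,s^{-1}(\nu)}$, and $\mathrm{Toep}_d^{\mathcal{W}}:=\{\mathbf{X}\in\mathrm{Toep}_d\mid s\star\mathbf{X}=\mathbf{X}\ \text{for all}\ s\in\mathcal{W}\}$. *)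

theory Defs
  imports "HOL-Analysis.Analysis" "HOL-Algebra.Group"
begin

text \<open>
  The space \<open>V\<close> is the whole type \<open>'a :: real_inner\<close>; finite dimension is a hypothesis where it
  is needed. The class \<open>euclidean_space\<close> is not used because it excludes dimension 0.
\<close>

definition full_lattice :: "'a::real_inner set \<Rightarrow> bool" where
  "full_lattice \<Omega> \<longleftrightarrow>
     (\<exists>B. finite B \<and> independent B \<and> span B = UNIV \<and>
          \<Omega> = range (\<lambda>k :: 'a \<Rightarrow> int. \<Sum>b\<in>B. of_int (k b) *\<^sub>R b))"

definition dual_lattice :: "'a::real_inner set \<Rightarrow> 'a set" where
  "dual_lattice \<Omega> = {l. \<forall>\<mu>\<in>\<Omega>. \<mu> \<bullet> l \<in> \<int>}"

definition Vor :: "'a::real_inner set \<Rightarrow> 'a set" where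
  "Vor \<Lambda> = {u. \<forall>l\<in>\<Lambda>. norm u \<le> norm (u - l)}"

text \<open>The finite set \<open>\<Omega>\<^sub>d\<close>.\<close>
definition trunc_lattice :: "'a::real_inner set \<Rightarrow> nat \<Rightarrow> 'a set" where
  "trunc_lattice \<Omega> d = \<Omega> \<inter> (\<lambda>u. real d *\<^sub>R u) ` Vor (dual_lattice \<Omega>)"

definition GL :: "('a::real_vector \<Rightarrow> 'a) monoid" where
  "GL = \<lparr>carrier = {s. linear s \<and> bij s}, mult = (\<circ>), one = id\<rparr>"

lemma group_GL: "group (GL :: ('a::real_vector \<Rightarrow> 'a) monoid)"
proof (rule groupI)
  fix s :: "'a \<Rightarrow> 'a" assume "s \<in> carrier GL"
  then have s: "linear s" "bij s" by (auto simp: GL_def)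
  then obtain t where t: "linear t" "t \<circ> s = id"
    using linear_injective_left_inverse bij_is_inj by blast
  moreover have "t = inv_into UNIV s"
    using t(2) s(2) by (metis bij_is_surj inv_unique_comp surj_iff comp_assoc comp_id id_comp)
  ultimately show "\<exists>t\<in>carrier GL. t \<otimes>\<^bsub>GL\<^esub> s = \<one>\<^bsub>GL\<^esub>"
    using s(2) by (auto simp: GL_def bij_imp_bij_inv)
qed (auto simp: GL_def linear_compose bij_comp linear_id comp_assoc)

definition trig_exp :: "'a::real_inner \<Rightarrow> 'a \<Rightarrow> complex" where
  "trig_exp \<mu> u = exp (- 2 * of_real pi * \<i> * of_real (\<mu> \<bullet> u))"

definition trig_coeffs :: "'a::real_inner set \<Rightarrow> ('a \<Rightarrow> complex) \<Rightarrow> bool" where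
  "trig_coeffs \<Omega> c \<longleftrightarrow>
     finite {\<mu>. c \<mu> \<noteq> 0} \<and> {\<mu>. c \<mu> \<noteq> 0} \<subseteq> \<Omega> \<and> (\<forall>\<mu>. c \<mu> = cnj (c (- \<mu>)))"

text \<open>
  The trigonometric polynomial with coefficients \<open>c\<close>, and its image under the action of \<open>s\<close>.
  Both are functions on \<open>V\<close>, so invariance below is an equality of functions.
\<close>
definition trig_poly :: "('a::real_inner \<Rightarrow> complex) \<Rightarrow> 'a \<Rightarrow> complex" where
  "trig_poly c u = (\<Sum>\<mu> | c \<mu> \<noteq> 0. c \<mu> * trig_exp \<mu> u)"

definition trig_act :: "('a::real_inner \<Rightarrow> 'a) \<Rightarrow> ('a \<Rightarrow> complex) \<Rightarrow> 'a \<Rightarrow> complex" where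
  "trig_act s c u = (\<Sum>\<mu> | c \<mu> \<noteq> 0. c \<mu> * trig_exp (s \<mu>) u)"

definition trig_invariant :: "('a::real_inner \<Rightarrow> 'a) set \<Rightarrow> ('a \<Rightarrow> complex) \<Rightarrow> bool" where
  "trig_invariant W c \<longleftrightarrow> (\<forall>s\<in>W. trig_act s c = trig_poly c)"

text \<open>
  Matrices with rows and columns indexed by \<open>\<Omega>\<^sub>d\<close> are functions \<open>'a \<Rightarrow> 'a \<Rightarrow> complex\<close> that
  vanish off \<open>\<Omega>\<^sub>d \<times> \<Omega>\<^sub>d\<close>, so that equality of functions is equality of matrices.
\<close>
definition Toep :: "'a::real_inner set \<Rightarrow> nat \<Rightarrow> ('a \<Rightarrow> 'a \<Rightarrow> complex) set" where
  "Toep \<Omega> d = (let I = trunc_lattice \<Omega> d in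
     {X. (\<forall>\<mu> \<nu>. \<mu> \<notin> I \<or> \<nu> \<notin> I \<longrightarrow> X \<mu> \<nu> = 0) \<and>
         (\<forall>\<mu>\<in>I. \<forall>\<nu>\<in>I. X \<nu> \<mu> = cnj (X \<mu> \<nu>)) \<and>
         (\<forall>\<mu>\<in>I. \<forall>\<nu>\<in>I. \<forall>\<mu>'\<in>I. \<forall>\<nu>'\<in>I. \<mu> - \<nu> = \<mu>' - \<nu>' \<longrightarrow> X \<mu> \<nu> = X \<mu>' \<nu>')})"

definition Evec :: "'a::real_inner set \<Rightarrow> nat \<Rightarrow> 'a \<Rightarrow> 'a \<Rightarrow> complex" where
  "Evec \<Omega> d u \<mu> = trig_exp \<mu> u / of_real (sqrt (real (card (trunc_lattice \<Omega> d))))"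

text \<open>The double sum is \<open>E\<^sub>d(u)\<^sup>\<dagger> X E\<^sub>d(u)\<close>.\<close>
definition mat_of :: "'a::real_inner set \<Rightarrow> nat \<Rightarrow> ('a \<Rightarrow> real) \<Rightarrow> 'a \<Rightarrow> 'a \<Rightarrow> complex" where
  "mat_of \<Omega> d f = (THE X. X \<in> Toep \<Omega> d \<and>
     (\<forall>u. of_real (f u) =
        (\<Sum>\<mu>\<in>trunc_lattice \<Omega> d. \<Sum>\<nu>\<in>trunc_lattice \<Omega> d.
           cnj (Evec \<Omega> d u \<mu>) * X \<mu> \<nu> * Evec \<Omega> d u \<nu>)))"

text \<open>
  Here \<open>inv_into UNIV s\<close> is the inverse function of \<open>s\<close>. If \<open>s\<close> maps \<open>\<Omega>\<^sub>d\<close> onto itself, the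
  result again vanishes off \<open>\<Omega>\<^sub>d \<times> \<Omega>\<^sub>d\<close>.
\<close>
definition mat_act :: "('a \<Rightarrow> 'a) \<Rightarrow> ('a \<Rightarrow> 'a \<Rightarrow> complex) \<Rightarrow> 'a \<Rightarrow> 'a \<Rightarrow> complex" where
  "mat_act s X \<mu> \<nu> = X (inv_into UNIV s \<mu>) (inv_into UNIV s \<nu>)"

definition Toep_inv ::
  "'a::real_inner set \<Rightarrow> ('a \<Rightarrow> 'a) set \<Rightarrow> nat \<Rightarrow> ('a \<Rightarrow> 'a \<Rightarrow> complex) set" where
  "Toep_inv \<Omega> W d = {X \<in> Toep \<Omega> d. \<forall>s\<in>W. mat_act s X = X}"

end

theory Submission
  imports Defs
begin

text \<open>
  The truncated lattice \<open>I = \<Omega>\<^sub>d\<close> is symmetric under negation, and it is finite: pairing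
  \<open>\<mu> \<in> I\<close> with a vector of the basis dual to a lattice basis gives an integer coordinate of
  \<open>\<mu>\<close>, and the inequalities defining the Voronoi cell bound this coordinate. Distinct
  exponentials are linearly independent (Dedekind's argument), so trigonometric polynomials
  may be compared coefficientwise.

  For a Toeplitz matrix \<open>X\<close>, the coefficient of \<open>\<ee>\<^sup>\<lambda>\<close> in the quadratic form
  \<open>E\<^sub>d(u)\<^sup>\<dagger> X E\<^sub>d(u)\<close> is \<open>1 / |I|\<close> times the sum of \<open>X\<^bsub>\<mu>\<nu>\<^esub>\<close> over the pairs of indices with
  \<open>\<nu> - \<mu> = \<lambda>\<close>, that is, the common value of these entries times their number \<open>N(\<lambda>)\<close>.
  Since the support of \<open>c\<close> lies in \<open>I + I = I - I\<close>, the matrix \<open>mat(f)\<close> therefore exists and is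
  given by \<open>X\<^bsub>\<mu>\<nu>\<^esub> = |I| c(\<nu> - \<mu>) / N(\<nu> - \<mu>)\<close> (lemma \<open>mat_of_eq_toep_mat\<close>).
  A linear bijection \<open>s\<close> with \<open>s(I) = I\<close> preserves \<open>N\<close>. Hence \<open>s\<close> fixes \<open>mat(f)\<close> exactly when
  \<open>c \<circ> s\<^sup>-\<^sup>1 = c\<close>, and by linear independence the same condition says that \<open>s\<close> fixes \<open>f\<close>.
\<close>

section \<open>Trigonometric polynomials and their coefficients\<close>

lemma trig_exp_add_arg: "trig_exp \<mu> (u + v) = trig_exp \<mu> u * trig_exp \<mu> v"
  by (simp add: trig_exp_def inner_add_right algebra_simps flip: exp_add)

lemma trig_exp_nonzero: "trig_exp \<mu> u \<noteq> 0"
  by (simp add: trig_exp_def)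

lemma cnj_trig_exp_mult: "cnj (trig_exp \<mu> u) * trig_exp \<nu> u = trig_exp (\<nu> - \<mu>) u"
  by (simp add: trig_exp_def inner_diff_left exp_cnj algebra_simps flip: exp_add)

lemma trig_exp_separates:
  fixes \<mu> \<nu> :: "'a::real_inner"
  assumes "\<mu> \<noteq> \<nu>"
  shows "\<exists>v. trig_exp \<mu> v \<noteq> trig_exp \<nu> v"
proof -
  define w where "w = \<mu> - \<nu>"
  \<comment> \<open>the scaling makes \<open>\<langle>\<mu> - \<nu>, v\<rangle> = 1/2\<close>, so that the two values differ by the factor \<open>-1\<close>\<close>
  define v where "v = (1 / (2 * (w \<bullet> w))) *\<^sub>R w"
  have "w \<bullet> w \<noteq> 0" using assms by (simp add: w_def)
  then have "w \<bullet> v = 1 / 2" by (simp add: v_def)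
  then have "\<mu> \<bullet> v = \<nu> \<bullet> v + 1 / 2" by (simp add: w_def inner_diff_left algebra_simps)
  then have "trig_exp \<mu> v = trig_exp \<nu> v * exp (- (of_real pi * \<i>))"
    by (simp add: trig_exp_def algebra_simps flip: exp_add)
  also have "exp (- (of_real pi * \<i>)) = -1"
    by (simp add: exp_minus)
  finally have "trig_exp \<mu> v = - trig_exp \<nu> v" by simp
  then show ?thesis using trig_exp_nonzero[of \<nu> v] by (intro exI[of _ v]) auto
qed

text \<open>
  Linear independence of the exponentials. Dedekind's argument: subtracting from a relation,
  translated by \<open>v\<close>, its multiple by \<open>\<ee>\<^sup>\<mu>(v)\<close> eliminates the term of \<open>\<mu>\<close>.
\<close>
lemma trig_exp_independent:
  fixes a :: "'a::real_inner \<Rightarrow> complex"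
  assumes "finite S" "\<And>u. (\<Sum>\<mu>\<in>S. a \<mu> * trig_exp \<mu> u) = 0" "\<mu> \<in> S"
  shows "a \<mu> = 0"
  using assms
proof (induction S arbitrary: a \<mu> rule: finite_induct)
  case empty
  then show ?case by simp
next
  case (insert m S)
  have rel: "a m * trig_exp m u + (\<Sum>\<mu>\<in>S. a \<mu> * trig_exp \<mu> u) = 0" for u
    using insert.prems(1)[of u] insert.hyps by simp
  have S0: "a \<nu> = 0" if "\<nu> \<in> S" for \<nu>
  proof -
    have "\<nu> \<noteq> m" using insert.hyps that by auto
    then obtain v where v: "trig_exp \<nu> v \<noteq> trig_exp m v" using trig_exp_separates by blast
    have "(\<Sum>\<mu>\<in>S. (a \<mu> * (trig_exp \<mu> v - trig_exp m v)) * trig_exp \<mu> u) = 0" for u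
    proof -
      have "(\<Sum>\<mu>\<in>S. (a \<mu> * (trig_exp \<mu> v - trig_exp m v)) * trig_exp \<mu> u)
          = (\<Sum>\<mu>\<in>S. a \<mu> * trig_exp \<mu> (u + v)) - trig_exp m v * (\<Sum>\<mu>\<in>S. a \<mu> * trig_exp \<mu> u)"
        by (simp add: trig_exp_add_arg sum_distrib_left algebra_simps flip: sum_subtractf)
      also have "(\<Sum>\<mu>\<in>S. a \<mu> * trig_exp \<mu> (u + v)) = - a m * trig_exp m (u + v)"
        using rel[of "u + v"] by (simp add: eq_neg_iff_add_eq_0 add.commute)
      also have "(\<Sum>\<mu>\<in>S. a \<mu> * trig_exp \<mu> u) = - a m * trig_exp m u"
        using rel[of u] by (simp add: eq_neg_iff_add_eq_0 add.commute)
      finally show ?thesis by (simp add: trig_exp_add_arg)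
    qed
    from insert.IH[OF this that] v show ?thesis by simp
  qed
  then have "a m = 0" using rel[of 0] trig_exp_nonzero[of m 0] by simp
  then show ?case using S0 insert.prems(2) by blast
qed

lemma trig_poly_eq_sum:
  assumes "finite S" "{\<mu>. c \<mu> \<noteq> 0} \<subseteq> S"
  shows "trig_poly c u = (\<Sum>\<mu>\<in>S. c \<mu> * trig_exp \<mu> u)"
  unfolding trig_poly_def using assms by (intro sum.mono_neutral_left) auto

lemma trig_poly_inject:
  assumes "finite {\<mu>. a \<mu> \<noteq> 0}" "finite {\<mu>. b \<mu> \<noteq> 0}"
  shows "trig_poly a = trig_poly b \<longleftrightarrow> a = b"
proof
  assume eq: "trig_poly a = trig_poly b"
  define S where "S = {\<mu>. a \<mu> \<noteq> 0} \<union> {\<mu>. b \<mu> \<noteq> 0}"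
  have S: "finite S" "{\<mu>. a \<mu> \<noteq> 0} \<subseteq> S" "{\<mu>. b \<mu> \<noteq> 0} \<subseteq> S"
    using assms by (auto simp: S_def)
  have "(\<Sum>\<mu>\<in>S. (a \<mu> - b \<mu>) * trig_exp \<mu> u) = 0" for u
    using fun_cong[OF eq, of u] S by (simp add: trig_poly_eq_sum[of S] left_diff_distrib sum_subtractf)
  then have "a \<mu> - b \<mu> = 0" if "\<mu> \<in> S" for \<mu>
    using trig_exp_independent[OF S(1), of "\<lambda>\<mu>. a \<mu> - b \<mu>"] that by blast
  then show "a = b" using S_def by fastforce
qed simp

lemma trig_act_eq_trig_poly:
  assumes "bij s"
  shows "trig_act s c = trig_poly (c \<circ> inv_into UNIV s)"
proof
  fix u
  have "bij_betw s {\<mu>. c \<mu> \<noteq> 0} {\<mu>. (c \<circ> inv_into UNIV s) \<mu> \<noteq> 0}"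
    by (rule bij_betw_byWitness[where f' = "inv_into UNIV s"])
       (use assms in \<open>auto simp: bij_is_inj bij_is_surj surj_f_inv_f\<close>)
  from sum.reindex_bij_betw[OF this, of "\<lambda>\<mu>. (c \<circ> inv_into UNIV s) \<mu> * trig_exp \<mu> u"]
  show "trig_act s c u = trig_poly (c \<circ> inv_into UNIV s) u"
    using assms by (simp add: trig_act_def trig_poly_def bij_is_inj)
qed

lemma trig_act_fixes_iff:
  assumes "bij s" "finite {\<mu>. c \<mu> \<noteq> 0}"
  shows "trig_act s c = trig_poly c \<longleftrightarrow> c \<circ> inv_into UNIV s = c"
proof -
  have "{\<mu>. (c \<circ> inv_into UNIV s) \<mu> \<noteq> 0} \<subseteq> s ` {\<mu>. c \<mu> \<noteq> 0}"
    using assms(1) by (auto simp: image_iff) (metis bij_inv_eq_iff)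
  then have "finite {\<mu>. (c \<circ> inv_into UNIV s) \<mu> \<noteq> 0}"
    using assms(2) finite_subset by blast
  then show ?thesis
    using assms by (simp add: trig_act_eq_trig_poly trig_poly_inject)
qed

section \<open>The truncated lattice is finite and symmetric\<close>

text \<open>
  Orthogonal projection \<open>y\<close> of \<open>a\<close> onto a finitely generated subspace; the ambient space need not
  be finite-dimensional.
\<close>
lemma orthogonal_projection_exists:
  fixes S :: "'a::real_inner set"
  assumes "finite S"
  shows "\<exists>y\<in>span S. \<forall>x\<in>span S. x \<bullet> (a - y) = 0"
proof -
  obtain C where C: "finite C" "span C = span S" "pairwise orthogonal C"
    using basis_orthogonal[OF assms] by blast
  define y where "y = (\<Sum>b\<in>C. (b \<bullet> a / (b \<bullet> b)) *\<^sub>R b)"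
  have "y \<in> span C" by (simp add: y_def span_sum span_scale span_base)
  moreover have "orthogonal (a - y) x" if "x \<in> C" for x
  proof -
    have "x \<bullet> y = (\<Sum>b\<in>C. if b = x then x \<bullet> a else 0)"
      unfolding y_def inner_sum_right
      using C(3) that by (intro sum.cong) (auto simp: pairwise_def orthogonal_def)
    then show ?thesis using C(1) that by (simp add: orthogonal_def inner_diff_right inner_commute[of _ x])
  qed
  then have "orthogonal (a - y) x" if "x \<in> span C" for x
    using orthogonal_to_span that by blast
  ultimately show ?thesis using C(2) by (auto simp: orthogonal_def inner_commute)
qed

text \<open>
  The dual vector of \<open>b\<close> is the component of \<open>b\<close> orthogonal to the span of the other basis
  vectors, rescaled.
\<close>
lemma dual_basis_exists:
  fixes B :: "'a::real_inner set"
  assumes "finite B" "independent B"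
  shows "\<exists>g. \<forall>b\<in>B. \<forall>b'\<in>B. b' \<bullet> g b = (if b' = b then 1 else 0)"
proof -
  have "\<exists>l. \<forall>b'\<in>B. b' \<bullet> l = (if b' = b then 1 else 0)" if b: "b \<in> B" for b
  proof -
    obtain y where y: "y \<in> span (B - {b})" "\<And>x. x \<in> span (B - {b}) \<Longrightarrow> x \<bullet> (b - y) = 0"
      using orthogonal_projection_exists[of "B - {b}" b] assms(1) by auto
    have "b \<notin> span (B - {b})" using assms(2) b dependent_def by blast
    then have "b - y \<noteq> 0" using y(1) by auto
    then have nz: "(b - y) \<bullet> (b - y) \<noteq> 0" by simp
    moreover have "(b - y) \<bullet> (b - y) = b \<bullet> (b - y)"
      using y(2)[OF y(1)] by (simp add: inner_diff_left)
    moreover have "b' \<bullet> (b - y) = 0" if "b' \<in> B" "b' \<noteq> b" for b'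
      using y(2) that by (simp add: span_base)
    ultimately have "\<forall>b'\<in>B. b' \<bullet> ((1 / (b \<bullet> (b - y))) *\<^sub>R (b - y)) = (if b' = b then 1 else 0)"
      by auto
    then show ?thesis by blast
  qed
  then show ?thesis by metis
qed

lemma minus_mem_dual_lattice: "l \<in> dual_lattice \<Omega> \<Longrightarrow> - l \<in> dual_lattice \<Omega>"
  by (auto simp: dual_lattice_def)

text \<open>Expand the squares in \<open>\<parallel>u\<parallel> \<le> \<parallel>u - l\<parallel>\<close> and \<open>\<parallel>u\<parallel> \<le> \<parallel>u + l\<parallel>\<close>.\<close>
lemma Vor_inner_bound:
  assumes "u \<in> Vor \<Lambda>" "l \<in> \<Lambda>" "- l \<in> \<Lambda>"
  shows "\<bar>u \<bullet> l\<bar> \<le> (l \<bullet> l) / 2"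
proof -
  have "norm u \<le> norm (u - l)" "norm u \<le> norm (u + l)"
    using assms by (auto simp: Vor_def)
  then have "u \<bullet> u \<le> (u - l) \<bullet> (u - l)" "u \<bullet> u \<le> (u + l) \<bullet> (u + l)"
    by (simp_all add: norm_le)
  then show ?thesis by (simp add: inner_diff inner_add inner_commute)
qed

lemma finite_trunc_lattice:
  fixes \<Omega> :: "'a::real_inner set"
  assumes "full_lattice \<Omega>"
  shows "finite (trunc_lattice \<Omega> d)"
proof -
  obtain B where B: "finite B" "independent B"
    and \<Omega>: "\<Omega> = range (\<lambda>k :: 'a \<Rightarrow> int. \<Sum>b\<in>B. of_int (k b) *\<^sub>R b)"
    using assms unfolding full_lattice_def by blast
  obtain g where g: "\<And>b b'. b \<in> B \<Longrightarrow> b' \<in> B \<Longrightarrow> b' \<bullet> g b = (if b' = b then 1 else 0)"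
    using dual_basis_exists[OF B] by blast
  have coord: "(\<Sum>b\<in>B. of_int (k b) *\<^sub>R b) \<bullet> g b' = of_int (k b')" if "b' \<in> B" for k :: "'a \<Rightarrow> int" and b'
  proof -
    have "(\<Sum>b\<in>B. of_int (k b) *\<^sub>R b) \<bullet> g b' = (\<Sum>b\<in>B. if b = b' then of_int (k b') else 0)"
      unfolding inner_sum_left using g that by (intro sum.cong) auto
    then show ?thesis using B(1) that by simp
  qed
  have dual: "g b \<in> dual_lattice \<Omega>" if "b \<in> B" for b
    using coord[OF that] by (auto simp: dual_lattice_def \<Omega>)
  define m where "m b = \<lceil>real d * ((g b \<bullet> g b) / 2)\<rceil>" for b
  define K where "K = (PiE B (\<lambda>b. {- m b .. m b}))"
  have "trunc_lattice \<Omega> d \<subseteq> (\<lambda>k. \<Sum>b\<in>B. of_int (k b) *\<^sub>R b) ` K"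
  proof
    fix x assume "x \<in> trunc_lattice \<Omega> d"
    then obtain u k where u: "u \<in> Vor (dual_lattice \<Omega>)" "x = real d *\<^sub>R u"
      and k: "x = (\<Sum>b\<in>B. of_int (k b) *\<^sub>R b)"
      by (auto simp: trunc_lattice_def \<Omega>)
    have "restrict k B \<in> K"
      unfolding K_def
    proof (intro restrict_PiE_iff[THEN iffD2] ballI)
      fix b assume b: "b \<in> B"
      have "\<bar>u \<bullet> g b\<bar> \<le> (g b \<bullet> g b) / 2"
        using Vor_inner_bound[OF u(1)] dual[OF b] minus_mem_dual_lattice by blast
      then have "real d * \<bar>u \<bullet> g b\<bar> \<le> real d * ((g b \<bullet> g b) / 2)"
        by (intro mult_left_mono) auto
      moreover have "of_int (k b) = real d * (u \<bullet> g b)"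
        using coord[OF b, of k] u(2) k by simp
      ultimately have "\<bar>of_int (k b)\<bar> \<le> real d * ((g b \<bullet> g b) / 2)"
        by (simp add: abs_mult)
      then have "\<bar>k b\<bar> \<le> m b" unfolding m_def by linarith
      then show "k b \<in> {- m b .. m b}" by auto
    qed
    moreover have "x = (\<Sum>b\<in>B. of_int (restrict k B b) *\<^sub>R b)" by (simp add: k)
    ultimately show "x \<in> (\<lambda>k. \<Sum>b\<in>B. of_int (k b) *\<^sub>R b) ` K" by blast
  qed
  moreover have "finite K" unfolding K_def using B(1) by (intro finite_PiE) auto
  ultimately show ?thesis using finite_subset by blast
qed

lemma minus_mem_full_lattice:
  fixes \<Omega> :: "'a::real_inner set"
  assumes "full_lattice \<Omega>" "x \<in> \<Omega>"
  shows "- x \<in> \<Omega>"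
proof -
  obtain B where \<Omega>: "\<Omega> = range (\<lambda>k :: 'a \<Rightarrow> int. \<Sum>b\<in>B. of_int (k b) *\<^sub>R b)"
    using assms(1) unfolding full_lattice_def by blast
  then obtain k where "x = (\<Sum>b\<in>B. of_int (k b) *\<^sub>R b)" using assms(2) by blast
  then have "- x = (\<Sum>b\<in>B. of_int ((\<lambda>b. - k b) b) *\<^sub>R b)" by (simp add: sum_negf)
  then show ?thesis unfolding \<Omega> by (rule range_eqI[where x = "\<lambda>b. - k b"])
qed

lemma minus_mem_Vor_dual_lattice:
  assumes "u \<in> Vor (dual_lattice \<Omega>)"
  shows "- u \<in> Vor (dual_lattice \<Omega>)"
  unfolding Vor_def
proof safe
  fix l assume "l \<in> dual_lattice \<Omega>"
  then have "norm u \<le> norm (u - - l)"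
    using assms minus_mem_dual_lattice unfolding Vor_def by blast
  also have "u - - l = - (- u - l)" by simp
  finally show "norm (- u) \<le> norm (- u - l)" by (simp only: norm_minus_cancel)
qed

lemma minus_mem_trunc_lattice:
  assumes "full_lattice \<Omega>" "x \<in> trunc_lattice \<Omega> d"
  shows "- x \<in> trunc_lattice \<Omega> d"
proof -
  obtain u where u: "u \<in> Vor (dual_lattice \<Omega>)" "x = real d *\<^sub>R u" and x: "x \<in> \<Omega>"
    using assms(2) by (auto simp: trunc_lattice_def)
  have "- x = real d *\<^sub>R (- u)" using u by simp
  then show ?thesis
    using minus_mem_Vor_dual_lattice[OF u(1)] minus_mem_full_lattice[OF assms(1) x]
    unfolding trunc_lattice_def by blast
qed

section \<open>The Toeplitz matrix of a trigonometric polynomial\<close>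

text \<open>
  The positions \<open>(\<mu>, \<nu>)\<close> on the diagonal of offset \<open>\<nu> - \<mu> = \<lambda>\<close>. Their number is the \<open>N(\<lambda>)\<close> of
  the introduction.
\<close>
definition diff_pairs :: "'a::ab_group_add set \<Rightarrow> 'a \<Rightarrow> ('a \<times> 'a) set" where
  "diff_pairs I l = {p \<in> I \<times> I. snd p - fst p = l}"

lemma finite_diff_pairs: "finite I \<Longrightarrow> finite (diff_pairs I l)"
  by (simp add: diff_pairs_def)

lemma card_diff_pairs_pos:
  assumes "finite I" "\<mu> \<in> I" "\<nu> \<in> I"
  shows "card (diff_pairs I (\<nu> - \<mu>)) > 0"
proof -
  have "(\<mu>, \<nu>) \<in> diff_pairs I (\<nu> - \<mu>)" using assms by (simp add: diff_pairs_def)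
  then show ?thesis using finite_diff_pairs[OF assms(1)] card_gt_0_iff by blast
qed

lemma card_diff_pairs_minus: "card (diff_pairs I (- l)) = card (diff_pairs I l)"
proof -
  have "bij_betw prod.swap (diff_pairs I l) (diff_pairs I (- l))"
    by (rule bij_betw_byWitness[where f' = prod.swap])
       (auto simp: diff_pairs_def, metis minus_diff_eq minus_minus)
  then show ?thesis by (simp add: bij_betw_same_card)
qed

lemma card_diff_pairs_linear:
  fixes s :: "'a::real_vector \<Rightarrow> 'a"
  assumes "linear s" "inj s" "s ` I = I"
  shows "card (diff_pairs I (s l)) = card (diff_pairs I l)"
proof -
  have "diff_pairs I (s l) = map_prod s s ` diff_pairs I l"
  proof (intro equalityI subsetI)
    fix p assume p: "p \<in> diff_pairs I (s l)"
    then have "fst p \<in> s ` I" "snd p \<in> s ` I" "snd p - fst p = s l"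
      by (auto simp: diff_pairs_def assms(3))
    then obtain \<mu> \<nu> where "\<mu> \<in> I" "\<nu> \<in> I" "p = (s \<mu>, s \<nu>)" "s \<nu> - s \<mu> = s l"
      by (metis imageE prod.collapse)
    moreover from this have "\<nu> - \<mu> = l"
      using assms by (metis linear_diff injD)
    ultimately show "p \<in> map_prod s s ` diff_pairs I l"
      by (auto simp: diff_pairs_def image_iff intro!: bexI[of _ "(\<mu>, \<nu>)"])
  next
    fix p assume "p \<in> map_prod s s ` diff_pairs I l"
    then show "p \<in> diff_pairs I (s l)"
      using assms by (auto simp: diff_pairs_def linear_diff)
  qed
  moreover have "inj_on (map_prod s s) (diff_pairs I l)"
    using assms(2) prod.inj_map inj_on_subset by blast
  ultimately show ?thesis by (simp add: card_image)
qed

text \<open>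
  The explicit formula for \<open>mat(f)\<close>, where \<open>c\<close> is the family of coefficients of \<open>f\<close> and \<open>I\<close> the
  index set. For finite \<open>I\<close> the denominator is positive at the positions in \<open>I \<times> I\<close>.
\<close>
definition toep_mat :: "'a::ab_group_add set \<Rightarrow> ('a \<Rightarrow> complex) \<Rightarrow> 'a \<Rightarrow> 'a \<Rightarrow> complex" where
  "toep_mat I c \<mu> \<nu> = (if \<mu> \<in> I \<and> \<nu> \<in> I
     then of_nat (card I) * c (\<nu> - \<mu>) / of_nat (card (diff_pairs I (\<nu> - \<mu>))) else 0)"

lemma toep_mat_in_Toep:
  assumes "\<And>\<mu>. c \<mu> = cnj (c (- \<mu>))"
  shows "toep_mat (trunc_lattice \<Omega> d) c \<in> Toep \<Omega> d"
proof -
  define I where "I = trunc_lattice \<Omega> d"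
  have "toep_mat I c \<nu> \<mu> = cnj (toep_mat I c \<mu> \<nu>)" for \<mu> \<nu>
  proof -
    have "c (\<mu> - \<nu>) = cnj (c (\<nu> - \<mu>))" using assms[of "\<mu> - \<nu>"] by simp
    moreover have "card (diff_pairs I (\<mu> - \<nu>)) = card (diff_pairs I (\<nu> - \<mu>))"
      using card_diff_pairs_minus[of I "\<nu> - \<mu>"] by simp
    ultimately show ?thesis by (simp add: toep_mat_def)
  qed
  moreover have "toep_mat I c \<mu> \<nu> = toep_mat I c \<mu>' \<nu>'"
    if "\<mu> \<in> I" "\<nu> \<in> I" "\<mu>' \<in> I" "\<nu>' \<in> I" "\<mu> - \<nu> = \<mu>' - \<nu>'" for \<mu> \<nu> \<mu>' \<nu>'
  proof -
    have "\<nu> - \<mu> = \<nu>' - \<mu>'" using that(5) by (metis minus_diff_eq)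
    then show ?thesis using that by (simp add: toep_mat_def)
  qed
  moreover have "toep_mat I c \<mu> \<nu> = 0" if "\<mu> \<notin> I \<or> \<nu> \<notin> I" for \<mu> \<nu>
    using that by (auto simp: toep_mat_def)
  ultimately show ?thesis
    unfolding Toep_def Let_def I_def[symmetric] by blast
qed

text \<open>The quadratic form of any matrix, grouped by diagonals.\<close>
lemma quadratic_form_eq_trig_sum:
  fixes \<Omega> :: "'a::real_inner set" and d :: nat
  defines "I \<equiv> trunc_lattice \<Omega> d"
  assumes "finite I" "finite D" "\<And>\<mu> \<nu>. \<mu> \<in> I \<Longrightarrow> \<nu> \<in> I \<Longrightarrow> \<nu> - \<mu> \<in> D"
  shows "(\<Sum>\<mu>\<in>I. \<Sum>\<nu>\<in>I. cnj (Evec \<Omega> d u \<mu>) * X \<mu> \<nu> * Evec \<Omega> d u \<nu>)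
       = (\<Sum>l\<in>D. (\<Sum>p\<in>diff_pairs I l. X (fst p) (snd p)) / of_nat (card I) * trig_exp l u)"
proof -
  define h where "h p = X (fst p) (snd p) / of_nat (card I) * trig_exp (snd p - fst p) u" for p
  have "complex_of_real (sqrt (card I)) * complex_of_real (sqrt (card I)) = of_nat (card I)"
    by (simp flip: of_real_mult)
  then have entry: "cnj (Evec \<Omega> d u \<mu>) * X \<mu> \<nu> * Evec \<Omega> d u \<nu> = h (\<mu>, \<nu>)" for \<mu> \<nu>
    unfolding Evec_def h_def cnj_trig_exp_mult[symmetric] I_def[symmetric]
    by (simp add: field_simps)
  have "(\<Sum>\<mu>\<in>I. \<Sum>\<nu>\<in>I. cnj (Evec \<Omega> d u \<mu>) * X \<mu> \<nu> * Evec \<Omega> d u \<nu>) = sum h (I \<times> I)"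
    unfolding entry by (simp add: sum.cartesian_product case_prod_eta)
  also have "\<dots> = (\<Sum>l\<in>D. sum h (diff_pairs I l))"
    unfolding diff_pairs_def
    by (rule sum.group[symmetric]) (use assms in auto)
  also have "\<dots> = (\<Sum>l\<in>D. (\<Sum>p\<in>diff_pairs I l. X (fst p) (snd p)) / of_nat (card I) * trig_exp l u)"
    by (intro sum.cong refl)
       (auto simp: h_def diff_pairs_def sum_divide_distrib sum_distrib_right intro!: sum.cong)
  finally show ?thesis .
qed

lemma sum_diff_pairs_toep_mat:
  assumes "finite I" "diff_pairs I l \<noteq> {}"
  shows "(\<Sum>p\<in>diff_pairs I l. toep_mat I c (fst p) (snd p)) = of_nat (card I) * c l"
proof -
  have "(\<Sum>p\<in>diff_pairs I l. toep_mat I c (fst p) (snd p))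
      = (\<Sum>p\<in>diff_pairs I l. of_nat (card I) * c l / of_nat (card (diff_pairs I l)))"
    by (intro sum.cong) (auto simp: toep_mat_def diff_pairs_def)
  moreover have "card (diff_pairs I l) \<noteq> 0"
    using finite_diff_pairs[OF assms(1)] assms(2) by simp
  ultimately show ?thesis by simp
qed

lemma sum_diff_pairs_Toep:
  assumes "X \<in> Toep \<Omega> d" "I = trunc_lattice \<Omega> d" "\<mu> \<in> I" "\<nu> \<in> I"
  shows "(\<Sum>p\<in>diff_pairs I (\<nu> - \<mu>). X (fst p) (snd p))
       = of_nat (card (diff_pairs I (\<nu> - \<mu>))) * X \<mu> \<nu>"
proof -
  have "X (fst p) (snd p) = X \<mu> \<nu>" if "p \<in> diff_pairs I (\<nu> - \<mu>)" for p
  proof -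
    have p: "fst p \<in> I" "snd p \<in> I" "snd p - fst p = \<nu> - \<mu>"
      using that by (auto simp: diff_pairs_def)
    then have "fst p - snd p = \<mu> - \<nu>" by (metis minus_diff_eq)
    then show ?thesis using assms p unfolding Toep_def Let_def by blast
  qed
  then show ?thesis by simp
qed

text \<open>
  Existence and uniqueness of the Toeplitz matrix representing \<open>f\<close>, with its entries. The support
  condition is what makes the representation possible.
\<close>
lemma mat_of_eq_toep_mat:
  fixes \<Omega> :: "'a::real_inner set" and d :: nat
  defines "I \<equiv> trunc_lattice \<Omega> d"
  assumes fin: "finite I" "finite {\<mu>. c \<mu> \<noteq> 0}"
    and herm: "\<And>\<mu>. c \<mu> = cnj (c (- \<mu>))"
    and supp: "\<And>\<mu>. c \<mu> \<noteq> 0 \<Longrightarrow> diff_pairs I \<mu> \<noteq> {}"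
    and f: "\<And>u. complex_of_real (f u) = trig_poly c u"
  shows "mat_of \<Omega> d f = toep_mat I c"
proof -
  define D where "D = (\<lambda>p. snd p - fst p) ` (I \<times> I)"
  have D: "finite D" "\<And>\<mu> \<nu>. \<mu> \<in> I \<Longrightarrow> \<nu> \<in> I \<Longrightarrow> \<nu> - \<mu> \<in> D"
    using fin by (auto simp: D_def image_iff)
  have D_iff: "l \<in> D \<longleftrightarrow> diff_pairs I l \<noteq> {}" for l
    unfolding D_def diff_pairs_def by blast
  have c_sum: "trig_poly c u = (\<Sum>l\<in>D. c l * trig_exp l u)" for u
    using D(1) supp by (intro trig_poly_eq_sum) (auto simp: D_iff)
  have form: "(\<Sum>\<mu>\<in>I. \<Sum>\<nu>\<in>I. cnj (Evec \<Omega> d u \<mu>) * X \<mu> \<nu> * Evec \<Omega> d u \<nu>)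
      = (\<Sum>l\<in>D. (\<Sum>p\<in>diff_pairs I l. X (fst p) (snd p)) / of_nat (card I) * trig_exp l u)" for X u
    unfolding I_def by (rule quadratic_form_eq_trig_sum) (use fin(1) D in \<open>auto simp: I_def\<close>)
  have repr: "(\<Sum>\<mu>\<in>I. \<Sum>\<nu>\<in>I. cnj (Evec \<Omega> d u \<mu>) * toep_mat I c \<mu> \<nu> * Evec \<Omega> d u \<nu>)
      = complex_of_real (f u)" for u
    unfolding form f c_sum
  proof (rule sum.cong[OF refl])
    fix l assume "l \<in> D"
    then have ne: "diff_pairs I l \<noteq> {}" by (simp add: D_iff)
    then have "card I \<noteq> 0" using fin(1) by (auto simp: diff_pairs_def)
    then show "(\<Sum>p\<in>diff_pairs I l. toep_mat I c (fst p) (snd p)) / of_nat (card I) * trig_exp l u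
        = c l * trig_exp l u"
      using sum_diff_pairs_toep_mat[OF fin(1) ne] by simp
  qed
  have uniq: "X = toep_mat I c"
    if X: "X \<in> Toep \<Omega> d" and Xf: "\<And>u. complex_of_real (f u) =
        (\<Sum>\<mu>\<in>I. \<Sum>\<nu>\<in>I. cnj (Evec \<Omega> d u \<mu>) * X \<mu> \<nu> * Evec \<Omega> d u \<nu>)" for X
  proof (intro ext)
    fix \<mu> \<nu>
    show "X \<mu> \<nu> = toep_mat I c \<mu> \<nu>"
    proof (cases "\<mu> \<in> I \<and> \<nu> \<in> I")
      case True
      define a where "a l = (\<Sum>p\<in>diff_pairs I l. X (fst p) (snd p)) / of_nat (card I) - c l" for l
      have "(\<Sum>l\<in>D. a l * trig_exp l u) = 0" for u
        using Xf[of u] unfolding form f c_sum by (simp add: a_def left_diff_distrib sum_subtractf)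
      then have "a (\<nu> - \<mu>) = 0"
        using trig_exp_independent[OF D(1)] D(2) True by blast
      then have "of_nat (card (diff_pairs I (\<nu> - \<mu>))) * X \<mu> \<nu> / of_nat (card I) = c (\<nu> - \<mu>)"
        using sum_diff_pairs_Toep[OF X I_def[THEN meta_eq_to_obj_eq]] True by (simp add: a_def)
      moreover have "card I \<noteq> 0" using fin(1) True by auto
      moreover have "card (diff_pairs I (\<nu> - \<mu>)) \<noteq> 0"
        using card_diff_pairs_pos[OF fin(1)] True by simp
      ultimately show ?thesis using True by (simp add: toep_mat_def field_simps)
    next
      case False
      then show ?thesis using X by (auto simp: Toep_def Let_def toep_mat_def I_def)
    qed
  qed
  show ?thesis
    unfolding mat_of_def I_def[symmetric]
  proof (rule the_equality)
    show "toep_mat I c \<in> Toep \<Omega> d \<and> (\<forall>u. complex_of_real (f u) =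
        (\<Sum>\<mu>\<in>I. \<Sum>\<nu>\<in>I. cnj (Evec \<Omega> d u \<mu>) * toep_mat I c \<mu> \<nu> * Evec \<Omega> d u \<nu>))"
      using toep_mat_in_Toep[of c \<Omega> d, OF herm] repr unfolding I_def by simp
  qed (use uniq in blast)
qed

section \<open>Invariance\<close>

lemma mat_act_toep_mat_fixes_iff:
  fixes s :: "'a::real_vector \<Rightarrow> 'a"
  assumes "finite I" "linear s" "bij s" "s ` I = I"
    and supp: "\<And>\<mu>. c \<mu> \<noteq> 0 \<Longrightarrow> diff_pairs I \<mu> \<noteq> {}"
  shows "mat_act s (toep_mat I c) = toep_mat I c \<longleftrightarrow> c \<circ> inv_into UNIV s = c"
proof -
  have s_inv: "s (inv_into UNIV s x) = x" "inv_into UNIV s (s x) = x" for x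
    using assms(3) by (simp_all add: bij_is_inj bij_is_surj surj_f_inv_f)
  have mem: "inv_into UNIV s x \<in> I \<longleftrightarrow> x \<in> I" for x
    using assms(4) s_inv by (metis image_eqI image_iff)
  have diff: "inv_into UNIV s x - inv_into UNIV s y = inv_into UNIV s (x - y)" for x y
  proof -
    have "s (inv_into UNIV s x - inv_into UNIV s y) = x - y"
      by (simp add: linear_diff[OF assms(2)] s_inv)
    then show ?thesis by (metis s_inv(2))
  qed
  have N: "card (diff_pairs I (inv_into UNIV s l)) = card (diff_pairs I l)" for l
    using card_diff_pairs_linear[OF assms(2) bij_is_inj[OF assms(3)] assms(4), of "inv_into UNIV s l"]
    by (simp add: s_inv)
  have act: "mat_act s (toep_mat I c) = toep_mat I (c \<circ> inv_into UNIV s)"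
    by (intro ext) (simp add: mat_act_def toep_mat_def mem diff N)
  show ?thesis
  proof
    assume fixed: "mat_act s (toep_mat I c) = toep_mat I c"
    show "c \<circ> inv_into UNIV s = c"
    proof
      fix l
      show "(c \<circ> inv_into UNIV s) l = c l"
      proof (cases "diff_pairs I l = {}")
        case True
        \<comment> \<open>neither \<open>l\<close> nor its preimage is a difference of indices, so both coefficients vanish\<close>
        then have "diff_pairs I (inv_into UNIV s l) = {}"
          using N[of l] finite_diff_pairs[OF assms(1)] by (metis card_eq_0_iff card.empty)
        then show ?thesis using True supp by (metis comp_apply)
      next
        case False
        then have "of_nat (card I) * (c \<circ> inv_into UNIV s) l = of_nat (card I) * c l"
          using sum_diff_pairs_toep_mat[OF assms(1) False] fixed act by metis
        moreover have "card I \<noteq> 0" using False assms(1) by (auto simp: diff_pairs_def)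
        ultimately show ?thesis by simp
      qed
    qed
  qed (simp add: act)
qed

theorem lemma2p3:
  fixes \<Omega> :: "'a::real_inner set"
    and W :: "('a \<Rightarrow> 'a) set"
    and c :: "'a \<Rightarrow> complex"
    and f :: "'a \<Rightarrow> real"
    and d :: nat
  assumes "\<exists>B :: 'a set. finite B \<and> span B = UNIV"
    and "full_lattice \<Omega>"
    and "subgroup W GL" and "finite W"
    and "\<forall>s\<in>W. s ` \<Omega> = \<Omega>"
    and "trig_coeffs \<Omega> c"
    and "\<forall>u. complex_of_real (f u) = trig_poly c u"
    and "\<forall>\<mu>. c \<mu> \<noteq> 0 \<longrightarrow> (\<exists>\<alpha>\<in>trunc_lattice \<Omega> d. \<exists>\<beta>\<in>trunc_lattice \<Omega> d. \<mu> = \<alpha> + \<beta>)"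
    and "\<forall>d'. (\<forall>\<mu>. c \<mu> \<noteq> 0 \<longrightarrow>
           (\<exists>\<alpha>\<in>trunc_lattice \<Omega> d'. \<exists>\<beta>\<in>trunc_lattice \<Omega> d'. \<mu> = \<alpha> + \<beta>)) \<longrightarrow> d \<le> d'"
    and "\<forall>s\<in>W. s ` trunc_lattice \<Omega> d = trunc_lattice \<Omega> d"
  shows "mat_of \<Omega> d f \<in> Toep_inv \<Omega> W d \<longleftrightarrow> trig_invariant W c"
proof -
  define I where "I = trunc_lattice \<Omega> d"
  have finI: "finite I" unfolding I_def by (rule finite_trunc_lattice[OF assms(2)])
  have c: "finite {\<mu>. c \<mu> \<noteq> 0}" "\<And>\<mu>. c \<mu> = cnj (c (- \<mu>))"
    using assms(6) unfolding trig_coeffs_def by blast+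
  have supp: "diff_pairs I \<mu> \<noteq> {}" if nz: "c \<mu> \<noteq> 0" for \<mu>
  proof -
    obtain \<alpha> \<beta> where ab: "\<alpha> \<in> I" "\<beta> \<in> I" "\<mu> = \<alpha> + \<beta>"
      using assms(8) nz unfolding I_def by blast
    moreover have "- \<alpha> \<in> I"
      using minus_mem_trunc_lattice[OF assms(2)] ab(1) unfolding I_def by blast
    ultimately have "(- \<alpha>, \<beta>) \<in> diff_pairs I \<mu>" by (simp add: diff_pairs_def)
    then show ?thesis by blast
  qed
  have mat: "mat_of \<Omega> d f = toep_mat I c"
    unfolding I_def
    using finI c supp assms(7) unfolding I_def by (intro mat_of_eq_toep_mat) blast+
  have Toep: "toep_mat I c \<in> Toep \<Omega> d" unfolding I_def using c(2) by (rule toep_mat_in_Toep)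
  have "mat_act s (toep_mat I c) = toep_mat I c \<longleftrightarrow> trig_act s c = trig_poly c" if "s \<in> W" for s
  proof -
    have s: "linear s" "bij s"
      using subgroup.subset[OF assms(3)] that by (auto simp: GL_def)
    have "s ` I = I" using assms(10) that by (simp add: I_def)
    then show ?thesis
      using mat_act_toep_mat_fixes_iff[OF finI s _ supp] trig_act_fixes_iff[OF s(2) c(1)] by simp
  qed
  then show ?thesis
    using Toep by (auto simp: mat Toep_inv_def trig_invariant_def)
qed

end
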